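(* If $n\ge m\ge 3$, then $\chi_{\rho}(P_m, P_n) = 3$.
   Context: For graphs $G$ and $H$ and a function $f\colon V(G)\to V(H)$, the Sierpiński product $G\otimes_f H$ is the graph with vertex set $V(G)\times V(H)$ whose edges are: $(g,h)(g,h')$ for every $g\in V(G)$ and every edge $hh'\in E(H)$; and $(g,f(g'))(g',f(g))$ for every edge $gg'\in E(G)$. Let $H^G$ denote the set of all functions $V(G)\to V(H)$. For a graph $X$, a packing $k$-coloring is a map $c\colon V(X)\to\{1,\dots,k\}$ such that whenever $u\neq v$ and $c(u)=c(v)=\ell$, the shortest-path distance satisfies $d_X(u,v)>\ell$; the packing chromatic number $\chi_\rho(X)$ is the least $k$ for which a packing $k$-coloring exists. The Sierpiński packing chromatic number of $(G,H)$ is $\chi_\rho(G,H)=\min_{f\in H^G}\chi_\rho(G\otimes_f H)$. $P_m$ denotes the path on $m$ vertices. *)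

theory Defs
  imports "Graph_Theory.Pair_Digraph" "Graph_Theory.Shortest_Path" "HOL-Library.FuncSet"
begin

text \<open>
  Simple undirected graphs are symmetric loop-free pair digraphs (locale \<^locale>\<open>pair_graph\<close>):
  an edge uv is the pair of arcs (u, v) and (v, u).
\<close>

definition path_graph :: "nat \<Rightarrow> nat pair_pre_digraph" where
  "path_graph n = \<lparr> pverts = {..<n},
     parcs = {(i, j). i < n \<and> j < n \<and> (j = Suc i \<or> i = Suc j)} \<rparr>"

definition sierpinski_product ::
  "'a pair_pre_digraph \<Rightarrow> ('a \<Rightarrow> 'b) \<Rightarrow> 'b pair_pre_digraph \<Rightarrow> ('a \<times> 'b) pair_pre_digraph" where
  "sierpinski_product G f H = \<lparr> pverts = pverts G \<times> pverts H,
     parcs = {((g, h), (g, h')) | g h h'. g \<in> pverts G \<and> (h, h') \<in> parcs H}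
           \<union> {((g, f g'), (g', f g)) | g g'. (g, g') \<in> parcs G} \<rparr>"

text \<open>
  Shortest-path distance with unit arc costs; it is infinite if there is no walk from u to v.
\<close>

definition graph_dist :: "'a pair_pre_digraph \<Rightarrow> 'a \<Rightarrow> 'a \<Rightarrow> ereal" where
  "graph_dist X u v = wf_digraph.\<mu> (with_proj X) (\<lambda>_. 1) u v"

definition packing_coloring :: "'a pair_pre_digraph \<Rightarrow> nat \<Rightarrow> ('a \<Rightarrow> nat) \<Rightarrow> bool" where
  "packing_coloring X k c \<longleftrightarrow>
     c \<in> pverts X \<rightarrow> {1..k} \<and>
     (\<forall>u\<in>pverts X. \<forall>v\<in>pverts X. u \<noteq> v \<and> c u = c v \<longrightarrow> graph_dist X u v > ereal (real (c u)))"

definition packing_chromatic_number :: "'a pair_pre_digraph \<Rightarrow> nat" where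
  "packing_chromatic_number X = (LEAST k. \<exists>c. packing_coloring X k c)"

text \<open>
  The extensional function space makes the set of maps between the (finite) vertex sets
  finite, so that \<^const>\<open>Min\<close> is a genuine minimum.
\<close>

definition sierpinski_packing_chromatic_number ::
  "'a pair_pre_digraph \<Rightarrow> 'b pair_pre_digraph \<Rightarrow> nat" where
  "sierpinski_packing_chromatic_number G H =
     Min ((\<lambda>f. packing_chromatic_number (sierpinski_product G f H)) ` (pverts G \<rightarrow>\<^sub>E pverts H))"

lemma pair_graph_path_graph: "pair_graph (path_graph n)"
proof
  show "finite (parcs (path_graph n))"
    by (rule finite_subset[of _ "{..<n} \<times> {..<n}"]) (auto simp: path_graph_def)
qed (auto simp: path_graph_def symmetric_def arcs_ends_def arc_to_ends_def intro!: symI)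

lemma pair_graph_sierpinski_product:
  assumes "pair_graph G" and "pair_graph H" and f: "f \<in> pverts G \<rightarrow> pverts H"
  shows "pair_graph (sierpinski_product G f H)"
proof -
  interpret G: pair_graph G by fact
  interpret H: pair_graph H by fact
  have sub: "parcs (sierpinski_product G f H) \<subseteq> (pverts G \<times> pverts H) \<times> (pverts G \<times> pverts H)"
    using f by (auto simp: sierpinski_product_def dest: G.in_arcsD1 G.in_arcsD2 H.in_arcsD1 H.in_arcsD2)
  show ?thesis
  proof
    show "finite (parcs (sierpinski_product G f H))"
      by (rule finite_subset[OF sub]) auto
    show "finite (pverts (sierpinski_product G f H))"
      by (auto simp: sierpinski_product_def)
    show "fst e \<in> pverts (sierpinski_product G f H)" "snd e \<in> pverts (sierpinski_product G f H)"
      if "e \<in> parcs (sierpinski_product G f H)" for e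
    proof -
      have "e \<in> (pverts G \<times> pverts H) \<times> (pverts G \<times> pverts H)"
        using that sub by blast
      moreover have "pverts (sierpinski_product G f H) = pverts G \<times> pverts H"
        by (simp add: sierpinski_product_def)
      ultimately show "fst e \<in> pverts (sierpinski_product G f H)" "snd e \<in> pverts (sierpinski_product G f H)"
        by (simp_all only: mem_Times_iff)
    qed
    show "fst e \<noteq> snd e" if "e \<in> parcs (sierpinski_product G f H)" for e
      using that G.pair_no_loops H.pair_no_loops by (fastforce simp: sierpinski_product_def)
    have "sym (parcs (sierpinski_product G f H))"
      using G.arcs_symmetric H.arcs_symmetric
      by (intro symI) (auto simp: sierpinski_product_def)
    then show "symmetric (with_proj (sierpinski_product G f H))"
      by (simp add: symmetric_def)
  qed
qed

lemma graph_dist_altdef: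
  assumes "pair_wf_digraph X"
  shows "graph_dist X u v =
    (INF p\<in>{p. pre_digraph.awalk (with_proj X) u p v}. ereal (real (length p)))"
proof -
  interpret pair_wf_digraph X by fact
  have "awalk_cost (\<lambda>_. 1) p = real (length p)" for p
    by (induction p) auto
  then show ?thesis
    by (simp add: graph_dist_def \<mu>_def)
qed

end

theory Submission
  imports Defs
begin

text \<open>
  Upper bound: choose f to follow the pattern 0, 0, n-1, n-1 periodically. Then consecutive
  copies of the second path are joined end to end, so the product is the path on mn vertices,
  and it is coloured periodically by 1, 2, 1, 3.
  Lower bound: for every f the edge between copies 0 and 1 extends to a path on four distinct
  vertices. In a packing 2-colouring an inner vertex of a path cannot have colour 1, since both
  of its neighbours would have colour 2 and lie at distance at most 2. So the two adjacent inner
  vertices both have colour 2, a contradiction.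
\<close>

lemma graph_dist_le_length:
  assumes "pair_wf_digraph X" and "pre_digraph.awalk (with_proj X) u p v"
  shows "graph_dist X u v \<le> ereal (real (length p))"
  unfolding graph_dist_altdef[OF assms(1)] using assms(2) by (auto intro: INF_lower)

lemma graph_dist_arc:
  assumes "pair_wf_digraph X" and "(u, v) \<in> parcs X"
  shows "graph_dist X u v \<le> 1"
proof -
  interpret pair_wf_digraph X by fact
  have "awalk u [(u, v)] v"
    using assms(2) in_arcsD1 by (auto simp: awalk_def)
  from graph_dist_le_length[OF assms(1) this] show ?thesis by (simp add: one_ereal_def)
qed

lemma graph_dist_two_arcs:
  assumes "pair_wf_digraph X" and "(u, v) \<in> parcs X" and "(v, w) \<in> parcs X"
  shows "graph_dist X u w \<le> 2"
proof -
  interpret pair_wf_digraph X by fact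
  have "awalk u [(u, v), (v, w)] w"
    using assms(2,3) in_arcsD1 by (auto simp: awalk_def)
  from graph_dist_le_length[OF assms(1) this] show ?thesis by simp
qed

text \<open>Each arc of a walk changes \<open>pos\<close> by at most 1, so a walk from
  \<open>u\<close> to \<open>v\<close> has at least \<open>\<bar>pos u - pos v\<bar>\<close> arcs;
  without any walk the infimum is infinite. This bounds distances from below without finding
  shortest walks.\<close>

lemma graph_dist_ge_Lipschitz:
  fixes pos :: "'a \<Rightarrow> int"
  assumes "pair_wf_digraph X" and lip: "\<And>a b. (a, b) \<in> parcs X \<Longrightarrow> \<bar>pos a - pos b\<bar> \<le> 1"
  shows "graph_dist X u v \<ge> ereal (real_of_int \<bar>pos u - pos v\<bar>)"
proof -
  interpret pair_wf_digraph X by fact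
  have "\<bar>pos u - pos v\<bar> \<le> int (length p)" if "set p \<subseteq> parcs X" "cas u p v" for p
    using that
  proof (induction p arbitrary: u)
    case (Cons e p)
    obtain a b where e: "e = (a, b)" by (cases e)
    then have "\<bar>pos u - pos b\<bar> \<le> 1" "\<bar>pos b - pos v\<bar> \<le> int (length p)"
      using Cons by (auto simp: lip)
    then show ?case by simp
  qed simp
  then have "real_of_int \<bar>pos u - pos v\<bar> \<le> real (length p)" if "awalk u p v" for p
    using that unfolding awalk_def by (metis of_int_le_iff of_int_of_nat_eq with_proj_simps(2))
  then show ?thesis
    unfolding graph_dist_altdef[OF assms(1)] by (auto intro!: INF_greatest)
qed

lemma packing_coloring_mono:
  "packing_coloring X k c \<Longrightarrow> k \<le> l \<Longrightarrow> packing_coloring X l c"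
  unfolding packing_coloring_def by fastforce

text \<open>An injective colouring meets the distance condition vacuously. Existence guarantees that
  the \<open>LEAST\<close> in \<open>packing_chromatic_number\<close> is attained.\<close>

lemma ex_packing_coloring:
  assumes "finite (pverts X)"
  shows "\<exists>k c. packing_coloring X k c"
proof -
  obtain c where "bij_betw c (pverts X) {1..card (pverts X)}"
    using ex_bij_betw_finite_nat[OF assms] bij_betw_trans bij_betw_iff_card
    by (metis assms card_atLeastAtMost diff_Suc_1 finite_atLeastAtMost)
  then have "packing_coloring X (card (pverts X)) c"
    unfolding packing_coloring_def bij_betw_def inj_on_def by auto
  then show ?thesis by blast
qed

lemma packing_chromatic_number_le:
  "packing_coloring X k c \<Longrightarrow> packing_chromatic_number X \<le> k"
  unfolding packing_chromatic_number_def by (blast intro: Least_le)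

lemma less_packing_chromatic_number:
  assumes "finite (pverts X)" and "\<And>c. \<not> packing_coloring X k c"
  shows "k < packing_chromatic_number X"
proof (rule ccontr)
  assume "\<not> k < packing_chromatic_number X"
  moreover have "\<exists>c. packing_coloring X (packing_chromatic_number X) c"
    unfolding packing_chromatic_number_def
    by (rule LeastI_ex) (use ex_packing_coloring[OF assms(1)] in blast)
  ultimately show False using assms(2) packing_coloring_mono not_less by blast
qed

lemma packing_2_coloring_inner_vertex:
  assumes X: "pair_graph X" and c: "packing_coloring X 2 c"
    and arcs: "(x, y) \<in> parcs X" "(y, z) \<in> parcs X" and "x \<noteq> z"
  shows "c y = 2"
proof (rule ccontr)
  interpret pair_graph X by fact
  note wf = pair_wf_digraph_axioms
  have V: "x \<in> pverts X" "y \<in> pverts X" "z \<in> pverts X"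
    using arcs in_arcsD1 in_arcsD2 by auto
  have C: "c v = 1 \<or> c v = 2" if "v \<in> pverts X" for v
  proof -
    have "c v \<in> {1..2}" using c that unfolding packing_coloring_def by blast
    then show ?thesis by auto
  qed
  have D: "graph_dist X u v > ereal (real (c u))"
    if "u \<in> pverts X" "v \<in> pverts X" "u \<noteq> v" "c u = c v" for u v
    using c that unfolding packing_coloring_def by blast
  assume "c y \<noteq> 2"
  then have y: "c y = 1" using C V by blast
  have "x \<noteq> y" "y \<noteq> z" using arcs pair_no_loops by fastforce+
  then have "c x \<noteq> 1" "c z \<noteq> 1"
    using D[of x y] D[of y z] V y graph_dist_arc[OF wf arcs(1)] graph_dist_arc[OF wf arcs(2)]
    by (auto simp: one_ereal_def)
  then have "c x = 2" "c z = 2" using C V by auto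
  then show False
    using D[of x z] V \<open>x \<noteq> z\<close> graph_dist_two_arcs[OF wf arcs] by auto
qed

lemma no_packing_2_coloring_path4:
  assumes X: "pair_graph X"
    and arcs: "(x, y) \<in> parcs X" "(y, z) \<in> parcs X" "(z, w) \<in> parcs X"
    and "x \<noteq> z" "y \<noteq> w"
  shows "\<not> packing_coloring X 2 c"
proof
  interpret pair_graph X by fact
  assume c: "packing_coloring X 2 c"
  have "c y = 2" "c z = 2"
    using packing_2_coloring_inner_vertex[OF X c] arcs \<open>x \<noteq> z\<close> \<open>y \<noteq> w\<close> by blast+
  moreover have "y \<in> pverts X" "z \<in> pverts X" "y \<noteq> z"
    using arcs in_arcsD1 in_arcsD2 pair_no_loops by fastforce+
  ultimately have "graph_dist X y z > 2"
    using c unfolding packing_coloring_def by fastforce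
  then show False
    using graph_dist_arc[OF pair_wf_digraph_axioms arcs(2)] by (auto simp: one_ereal_def dest: less_le_trans)
qed

text \<open>Distinct even positions differ by at least 2, which suffices for colour 1. Each of the
  residues 1 and 3 modulo 4 has its own colour, so repetitions are at least 4 apart, which suffices
  for colours 2 and 3.\<close>

lemma packing_3_coloring_of_linear_layout:
  fixes pos :: "'a \<Rightarrow> int"
  assumes "pair_wf_digraph X" and "inj_on pos (pverts X)"
    and lip: "\<And>a b. (a, b) \<in> parcs X \<Longrightarrow> \<bar>pos a - pos b\<bar> \<le> 1"
  shows "packing_coloring X 3
    (\<lambda>v. if pos v mod 4 = 1 then 2 else if pos v mod 4 = 3 then 3 else 1)"
  (is "packing_coloring X 3 ?c")
proof -
  have "graph_dist X u v > ereal (real (?c u))"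
    if "u \<in> pverts X" "v \<in> pverts X" "u \<noteq> v" "?c u = ?c v" for u v
  proof -
    have "pos u \<noteq> pos v"
      using assms(2) that(1-3) by (auto dest: inj_onD)
    then have "int (?c u) < \<bar>pos u - pos v\<bar>"
      using that(4) by (simp split: if_splits) presburger+
    then have "real (?c u) < real_of_int \<bar>pos u - pos v\<bar>"
      by linarith
    then show ?thesis
      using graph_dist_ge_Lipschitz[OF assms(1) lip, where u = u and v = v]
      by (meson less_ereal.simps(1) less_le_trans)
  qed
  then show ?thesis unfolding packing_coloring_def by auto
qed

lemma path_graph_ex_neighbour:
  assumes "h < n" "n \<ge> 2"
  shows "\<exists>h'. (h, h') \<in> parcs (path_graph n) \<and> (h', h) \<in> parcs (path_graph n)"
proof (cases h)
  case 0
  then show ?thesis using assms by (intro exI[of _ 1]) (auto simp: path_graph_def)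
next
  case (Suc k)
  then show ?thesis using assms by (intro exI[of _ k]) (auto simp: path_graph_def)
qed

lemma packing_chromatic_number_sierpinski_paths_ge_3:
  assumes "m \<ge> 2" "n \<ge> 2" and f: "f \<in> pverts (path_graph m) \<rightarrow> pverts (path_graph n)"
  shows "packing_chromatic_number (sierpinski_product (path_graph m) f (path_graph n)) \<ge> 3"
proof -
  let ?X = "sierpinski_product (path_graph m) f (path_graph n)"
  have X: "pair_graph ?X"
    by (intro pair_graph_sierpinski_product pair_graph_path_graph f)
  have "f 0 < n" "f 1 < n"
    using f assms(1) by (auto simp: path_graph_def)
  then obtain h h' where h: "(h, f 1) \<in> parcs (path_graph n)" "(f 0, h') \<in> parcs (path_graph n)"
    using path_graph_ex_neighbour assms(2) by metis
  \<comment> \<open>The four vertices of the path in order; the middle arc joins copies 0 and 1.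
    Vertices two steps apart lie in different copies, hence are distinct.\<close>
  have "((0, h), (0, f 1)) \<in> parcs ?X" "((0, f 1), (1, f 0)) \<in> parcs ?X"
    "((1, f 0), (1, h')) \<in> parcs ?X"
    using h assms(1) by (auto simp: sierpinski_product_def path_graph_def)
  then have "\<not> packing_coloring ?X 2 c" for c
    by (rule no_packing_2_coloring_path4[OF X]) auto
  moreover have "finite (pverts ?X)"
    by (simp add: sierpinski_product_def path_graph_def)
  ultimately show ?thesis
    using less_packing_chromatic_number[of ?X 2] by simp
qed

text \<open>The values at \<open>g - 1\<close> and \<open>g + 1\<close> are always opposite ends of
  the second path, so an inner copy \<open>g\<close> is entered at one end and left at the
  other.\<close>

definition zigzag :: "nat \<Rightarrow> nat \<Rightarrow> nat" where
  "zigzag n g = (if g mod 4 < 2 then 0 else n - 1)"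

text \<open>
  The position of a vertex on the Hamiltonian path of the product with f = zigzag n: copy g is
  entered at zigzag n (g - 1) and left at zigzag n (g + 1), so it is traversed upwards iff
  g mod 4 is 1 or 2.
\<close>

definition zigzag_pos :: "nat \<Rightarrow> nat \<times> nat \<Rightarrow> int" where
  "zigzag_pos n = (\<lambda>(g, h). int g * int n +
     (if g mod 4 = 1 \<or> g mod 4 = 2 then int h else int n - 1 - int h))"

text \<open>The connecting edge leaves copy \<open>g\<close> at its last position,
  \<open>g * n + n - 1\<close>, and enters the next copy at its first,
  \<open>(g + 1) * n\<close>.\<close>

lemma zigzag_pos_step:
  assumes "n \<ge> 1"
  shows "zigzag_pos n (Suc g, zigzag n g) = zigzag_pos n (g, zigzag n (Suc g)) + 1"
proof -
  have "g mod 4 = 0 \<or> g mod 4 = 1 \<or> g mod 4 = 2 \<or> g mod 4 = 3" by linarith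
  then show ?thesis
    using assms
    by (elim disjE) (simp_all add: zigzag_pos_def zigzag_def mod_Suc algebra_simps of_nat_diff)
qed

text \<open>Copy \<open>g\<close> occupies the \<open>n\<close> positions starting at
  \<open>g * n\<close>, so integer division by \<open>n\<close> recovers \<open>g\<close>; within a
  copy the position is strictly monotone in \<open>h\<close>.\<close>

lemma zigzag_pos_inj: "inj_on (zigzag_pos n) (UNIV \<times> {..<n})"
proof (rule inj_onI, clarsimp)
  fix g h g' h'
  assume h: "h < n" "h' < n" and eq: "zigzag_pos n (g, h) = zigzag_pos n (g', h')"
  have "zigzag_pos n (a, b) div int n = int a" if "b < n" for a b
    using that by (auto simp: zigzag_pos_def)
  then have "g = g'" using h eq by (metis of_nat_eq_iff)
  with eq show "g = g' \<and> h = h'" by (auto simp: zigzag_pos_def split: if_splits)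
qed

lemma zigzag_pos_Lipschitz:
  assumes f: "\<And>g. g < m \<Longrightarrow> f g = zigzag n g" and "n \<ge> 1"
    and "(a, b) \<in> parcs (sierpinski_product (path_graph m) f (path_graph n))"
  shows "\<bar>zigzag_pos n a - zigzag_pos n b\<bar> \<le> 1"
proof -
  \<comment> \<open>An edge inside a copy, or a connecting edge in one of its two
    directions.\<close>
  consider g h h' where "a = (g, h)" "b = (g, h')" "h = Suc h' \<or> h' = Suc h"
    | g where "a = (g, zigzag n (Suc g))" "b = (Suc g, zigzag n g)"
    | g where "b = (g, zigzag n (Suc g))" "a = (Suc g, zigzag n g)"
    using assms(3) by (auto simp: sierpinski_product_def path_graph_def f)
  then show ?thesis
  proof cases
    case 1
    then show ?thesis by (auto simp: zigzag_pos_def)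
  qed (use zigzag_pos_step[OF \<open>n \<ge> 1\<close>] in simp_all)
qed

theorem theorem4p1:
  fixes m n :: nat
  assumes "n \<ge> m" and "m \<ge> 3"
  shows "sierpinski_packing_chromatic_number (path_graph m) (path_graph n) = 3"
proof -
  let ?F = "pverts (path_graph m) \<rightarrow>\<^sub>E pverts (path_graph n)"
  let ?X = "\<lambda>f. sierpinski_product (path_graph m) f (path_graph n)"
  have ge: "packing_chromatic_number (?X f) \<ge> 3" if "f \<in> ?F" for f
    using packing_chromatic_number_sierpinski_paths_ge_3[of m n f] that assms
    by (auto simp: PiE_iff)
  \<comment> \<open>The restriction makes \<open>f\<close> extensional, as the set underlying the
    minimum demands; its values on the vertices remain those of \<open>zigzag n\<close>.\<close>
  define f where "f = restrict (zigzag n) {..<m}"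
  have f: "f \<in> ?F"
    using assms by (auto simp: f_def zigzag_def path_graph_def)
  interpret pair_graph "?X f"
    using f by (intro pair_graph_sierpinski_product pair_graph_path_graph) (auto simp: PiE_iff)
  have "inj_on (zigzag_pos n) (pverts (?X f))"
    by (rule inj_on_subset[OF zigzag_pos_inj]) (auto simp: sierpinski_product_def path_graph_def)
  moreover have "\<bar>zigzag_pos n a - zigzag_pos n b\<bar> \<le> 1" if "(a, b) \<in> parcs (?X f)" for a b
    using zigzag_pos_Lipschitz[OF _ _ that] assms by (simp add: f_def)
  ultimately have "packing_chromatic_number (?X f) \<le> 3"
    by (intro packing_chromatic_number_le[OF packing_3_coloring_of_linear_layout]
      pair_wf_digraph_axioms)
  then have "3 = packing_chromatic_number (?X f)"
    using ge[OF f] by simp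
  moreover have "finite ?F"
    by (intro finite_PiE) (auto simp: path_graph_def)
  ultimately show ?thesis
    unfolding sierpinski_packing_chromatic_number_def
    using f ge by (intro Min_eqI) auto
qed

end
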